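(* Let $r>1$ be an integer and let $G$ be a finite, simple, connected, undirected graph. If $G$ contains no induced subgraph isomorphic to a triangle $K_3$ and no induced subgraph isomorphic to the star $K_{1,r}$, then $\pi(G)\leq r$, where $\pi(G)$ denotes the power of $G$.
   Context: For a vertex $v$ of a graph $G$, $N[v]$ is the closed neighborhood of $v$ (that is, $v$ together with all its neighbors). A set $S\subseteq V(G)$ dominates $G$ if every vertex of $G$ lies in $S$ or is adjacent to a vertex of $S$. The domination number $\gamma(G)$ is the minimum cardinality of a dominating set, and a $\gamma$-set is a dominating set of cardinality $\gamma(G)$. For a $\gamma$-set $D$ of $G$, the allegiance of $D$ with respect to $G$ is $a_G(D)=\max_{v\in V(G)}|D\cap N[v]|$. The power of $G$ is $\pi(G)=\min_D a_G(D)$, the minimum taken over all $\gamma$-sets $D$ of $G$. *)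

theory Defs
  imports "Graph_Theory.Graph_Theory"
begin

text \<open>A finite simple undirected graph is a symmetric digraph without loops and parallel arcs
  (locale \<^locale>\<open>graph\<close>): an edge is a pair of opposite arcs. On a graph, \<^const>\<open>connected\<close>
  demands a nonempty vertex set, so every minimum and maximum below is over a finite nonempty set.\<close>

definition closed_neighborhood :: "('a, 'b) pre_digraph \<Rightarrow> 'a \<Rightarrow> 'a set" where
  "closed_neighborhood G v = insert v {u \<in> verts G. v \<rightarrow>\<^bsub>G\<^esub> u}"

definition dominating_set :: "('a, 'b) pre_digraph \<Rightarrow> 'a set \<Rightarrow> bool" where
  "dominating_set G S \<longleftrightarrow>
     S \<subseteq> verts G \<and> (\<forall>v \<in> verts G. v \<in> S \<or> (\<exists>s \<in> S. v \<rightarrow>\<^bsub>G\<^esub> s))"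

definition domination_number :: "('a, 'b) pre_digraph \<Rightarrow> nat" where
  "domination_number G = Min (card ` {S. dominating_set G S})"

definition gamma_set :: "('a, 'b) pre_digraph \<Rightarrow> 'a set \<Rightarrow> bool" where
  "gamma_set G D \<longleftrightarrow> dominating_set G D \<and> card D = domination_number G"

definition allegiance :: "('a, 'b) pre_digraph \<Rightarrow> 'a set \<Rightarrow> nat" where
  "allegiance G D = Max ((\<lambda>v. card (D \<inter> closed_neighborhood G v)) ` verts G)"

definition graph_power :: "('a, 'b) pre_digraph \<Rightarrow> nat" where
  "graph_power G = Min (allegiance G ` {D. gamma_set G D})"

end

theory Submission
  imports Defs
begin

text \<open>The neighbours of a vertex are pairwise nonadjacent because there is no triangle, so \<open>r\<close> of
  them would induce a \<open>K\<^sub>1\<^sub>,\<^sub>r\<close>. Hence every closed neighbourhood has at most \<open>r\<close> elements, and so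
  does its intersection with any \<open>\<gamma>\<close>-set.\<close>

lemma arcs_ends_induce_subgraph:
  "arcs_ends (G \<restriction> S) = {(u, v) \<in> arcs_ends G. u \<in> S \<and> v \<in> S}"
  by (auto simp: arcs_ends_def arc_to_ends_def)

context graph
begin

lemma graph_induce_subgraph:
  assumes "S \<subseteq> verts G"
  shows "graph (G \<restriction> S)"
proof -
  have ind: "induced_subgraph (G \<restriction> S) G"
    using assms by (rule induced_induce)
  have "symmetric (G \<restriction> S)"
    using sym_arcs ind by (rule induced_graph_imp_symmetric)
  moreover have "digraph (G \<restriction> S)"
    using ind by (rule digraphI_induced)
  ultimately show ?thesis
    by (simp add: digraph.graphI)
qed

lemma triangle_imp_induced_K3:
  assumes "u \<rightarrow> v" "v \<rightarrow> w" "u \<rightarrow> w"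
  shows "\<exists>H. induced_subgraph H G \<and> K\<^bsub>3\<^esub> H"
proof (intro exI conjI)
  have neq: "u \<noteq> v" "v \<noteq> w" "u \<noteq> w"
    using assms adj_not_same by auto
  have sub: "{u, v, w} \<subseteq> verts G"
    using assms adj_in_verts by auto
  show "induced_subgraph (G \<restriction> {u, v, w}) G"
    using sub by (rule induced_induce)
  \<comment> \<open>Symmetry supplies the three reverse arcs; the absence of loops rules out the
    diagonal pairs.\<close>
  have "arcs_ends (G \<restriction> {u, v, w}) = {(x, y). (x, y) \<in> {u, v, w} \<times> {u, v, w} \<and> x \<noteq> y}"
    using assms assms[THEN graph_symmetric] by (auto simp: arcs_ends_induce_subgraph dest: adj_not_same)
  then show "K\<^bsub>3\<^esub> (G \<restriction> {u, v, w})"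
    using graph_induce_subgraph[OF sub] neq by (simp add: complete_digraph_def)
qed

lemma independent_neighbours_imp_induced_star:
  assumes T: "\<And>u. u \<in> T \<Longrightarrow> v \<rightarrow> u"
    and indep: "\<And>u w. u \<in> T \<Longrightarrow> w \<in> T \<Longrightarrow> \<not> (u \<rightarrow> w)"
    and v: "v \<in> verts G"
  shows "\<exists>H. induced_subgraph H G \<and> K\<^bsub>1,card T\<^esub> H"
proof (intro exI conjI)
  have sub: "insert v T \<subseteq> verts G"
    using adj_in_verts(2)[OF T] v by blast
  show "induced_subgraph (G \<restriction> insert v T) G"
    using sub by (rule induced_induce)
  have "v \<notin> T"
    using T adj_not_same by blast
  moreover have "arcs_ends (G \<restriction> insert v T) = {v} \<times> T \<union> T \<times> {v}"
    using T T[THEN graph_symmetric] indep adj_not_same[of v]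
    by (auto simp: arcs_ends_induce_subgraph)
  \<comment> \<open>This is the body of the existential in
    \<open>complete_bipartite_digraph_def\<close> for the parts \<open>{v}\<close> and
    \<open>T\<close>; the trivial \<open>card T = card T\<close> is kept to match it.\<close>
  ultimately have "verts (G \<restriction> insert v T) = {v} \<union> T \<and> {v} \<inter> T = {} \<and> card {v} = 1 \<and>
      card T = card T \<and> arcs_ends (G \<restriction> insert v T) = {v} \<times> T \<union> T \<times> {v}"
    by simp
  then show "K\<^bsub>1,card T\<^esub> (G \<restriction> insert v T)"
    unfolding complete_bipartite_digraph_def using graph_induce_subgraph[OF sub] by blast
qed

lemma card_closed_neighborhood_le:
  assumes no_K3: "\<not> (\<exists>H. induced_subgraph H G \<and> K\<^bsub>3\<^esub> H)"
    and no_star: "\<not> (\<exists>H. induced_subgraph H G \<and> K\<^bsub>1,r\<^esub> H)"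
    and v: "v \<in> verts G"
  shows "card (closed_neighborhood G v) \<le> r"
proof -
  let ?N = "{u \<in> verts G. v \<rightarrow> u}"
  have "card ?N < r"
  proof (rule ccontr)
    assume "\<not> card ?N < r"
    \<comment> \<open>The excluded star has exactly \<open>r\<close> leaves, so a possibly larger
      neighbourhood is cut down to size \<open>r\<close>.\<close>
    then obtain T where T: "T \<subseteq> ?N" "card T = r"
      by (meson not_less obtain_subset_with_card_n)
    have "\<not> (u \<rightarrow> w)" if "u \<in> T" "w \<in> T" for u w
      using that T(1) no_K3 triangle_imp_induced_K3[of v u w] by fast
    then show False
      using independent_neighbours_imp_induced_star[of T v] T v no_star
      by (metis (no_types, lifting) mem_Collect_eq subsetD)
  qed
  then show ?thesis
    \<comment> \<open>The strict bound on the neighbours leaves room for \<open>v\<close>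
      itself.\<close>
    using card_insert_le_m1[of r ?N v] by (simp add: closed_neighborhood_def)
qed

text \<open>Finiteness lets the \<open>Min\<close> in \<open>domination_number\<close> and
  \<open>graph_power\<close> be used as a true minimum.\<close>

lemma finite_dominating_sets: "finite {S. dominating_set G S}"
  by (rule finite_subset[of _ "Pow (verts G)"]) (auto simp: dominating_set_def)

text \<open>The whole vertex set dominates, so the minimum is over a nonempty set and is
  attained.\<close>

lemma ex_gamma_set: "\<exists>D. gamma_set G D"
proof -
  have "dominating_set G (verts G)"
    by (auto simp: dominating_set_def)
  then have "domination_number G \<in> card ` {S. dominating_set G S}"
    unfolding domination_number_def using finite_dominating_sets by (intro Min_in) auto
  then show ?thesis
    by (auto simp: gamma_set_def)
qed

lemma graph_power_le_allegiance:
  assumes "gamma_set G D"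
  shows "graph_power G \<le> allegiance G D"
  unfolding graph_power_def using assms
  by (intro Min_le finite_imageI finite_subset[OF _ finite_dominating_sets])
    (auto simp: gamma_set_def)

lemma allegiance_le:
  assumes "verts G \<noteq> {}" and "\<And>v. v \<in> verts G \<Longrightarrow> card (closed_neighborhood G v) \<le> r"
  shows "allegiance G D \<le> r"
proof -
  have "card (D \<inter> closed_neighborhood G v) \<le> r" if "v \<in> verts G" for v
    using assms(2)[OF that]
    \<comment> \<open>The rotation lets the chained bound fix the larger set; finiteness and
      inclusion remain.\<close>
    by (rule order_trans[OF card_mono, rotated 2]) (auto simp: closed_neighborhood_def)
  then show ?thesis
    unfolding allegiance_def using assms(1) by (intro Max.boundedI) auto
qed

end

theorem proposition2p2:
  fixes G :: "('a, 'b) pre_digraph" and r :: nat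
  assumes "r > 1"
    and "graph G"
    and "connected G"
    and "\<not> (\<exists>H. induced_subgraph H G \<and> K\<^bsub>3\<^esub> H)"
    and "\<not> (\<exists>H. induced_subgraph H G \<and> K\<^bsub>1,r\<^esub> H)"
  shows "graph_power G \<le> r"
proof -
  interpret graph G by fact
  obtain D where "gamma_set G D"
    using ex_gamma_set by blast
  then have "graph_power G \<le> allegiance G D"
    by (rule graph_power_le_allegiance)
  also have "\<dots> \<le> r"
  proof (rule allegiance_le)
    \<comment> \<open>Connectedness supplies a vertex, so the \<open>Max\<close> in
      \<open>allegiance\<close> is over a nonempty set.\<close>
    show "verts G \<noteq> {}"
      using assms(3) by (auto simp: connected_def strongly_connected_def)
  qed (rule card_closed_neighborhood_le[OF assms(4,5)])
  finally show ?thesis .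
qed

end
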